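(* For any pair $f\colon E\to B$, $g\colon E'\to B'$ of exterior maps, $$\mathrm{e\text{-}secat}(f\times g)\le \mathrm{e\text{-}secat}(f)+\mathrm{e\text{-}secat}(g).$$
   Context: All spaces are assumed metrizable. Write $I=[0,1]$. An exterior space is a topological space $(X,\tau)$ with a nonempty family $\mathcal E\subseteq\tau$ (the externology; its members are the exterior sets) closed under finite intersections and such that $U\in\tau$, $U\supseteq E\in\mathcal E$ implies $U\in\mathcal E$. A map of exterior spaces is exterior if it is continuous and preimages of exterior sets are exterior. A subspace $A$ of an exterior space carries the relative externology (the coarsest one making the inclusion exterior): the open subsets of $A$ containing $E\cap A$ for some exterior $E$. The product $X\times Y$ carries the externology of open sets containing $E\times E'$ for some exterior $E\subseteq X$, $E'\subseteq Y$. $I_{tr}$ is $I$ with externology $\{I\}$; an exterior homotopy between exterior maps $X\to Y$ is a homotopy that is an exterior map $X\times I_{tr}\to Y$. Let $f\colon X\to Y$ be an exterior map. An open subset $U\subseteq Y$ (not necessarily exterior, with the relative externology) is e-sectional if there is an exterior map $s\colon U\to X$ with $f\circ s$ exterior homotopic to the inclusion $U\hookrightarrow Y$. $\mathrm{e\text{-}secat}(f)$ is the least integer $k$ such that $Y$ is covered by $k+1$ e-sectional open subsets ($\infty$ if there is none). *)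

theory Defs
  imports "HOL-Analysis.Analysis" "HOL-Library.Extended_Nat"
begin

record 'a ext_space =
  topol :: "'a topology"
  externology :: "'a set set"

definition exterior_space :: "'a ext_space \<Rightarrow> bool" where
  "exterior_space X \<longleftrightarrow>
     externology X \<noteq> {} \<and>
     (\<forall>E \<in> externology X. openin (topol X) E) \<and>
     (\<forall>E \<in> externology X. \<forall>E' \<in> externology X. E \<inter> E' \<in> externology X) \<and>
     (\<forall>E \<in> externology X. \<forall>U. openin (topol X) U \<and> E \<subseteq> U \<longrightarrow> U \<in> externology X)"

definition exterior_map :: "'a ext_space \<Rightarrow> 'b ext_space \<Rightarrow> ('a \<Rightarrow> 'b) \<Rightarrow> bool" where
  "exterior_map X Y f \<longleftrightarrow>
     continuous_map (topol X) (topol Y) f \<and>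
     (\<forall>E \<in> externology Y. {x \<in> topspace (topol X). f x \<in> E} \<in> externology X)"

definition ext_subspace :: "'a ext_space \<Rightarrow> 'a set \<Rightarrow> 'a ext_space" where
  "ext_subspace X A =
     \<lparr> topol = subtopology (topol X) A,
       externology = {U. openin (subtopology (topol X) A) U \<and>
                         (\<exists>E \<in> externology X. E \<inter> A \<subseteq> U)} \<rparr>"

definition ext_prod :: "'a ext_space \<Rightarrow> 'b ext_space \<Rightarrow> ('a \<times> 'b) ext_space" where
  "ext_prod X Y =
     \<lparr> topol = prod_topology (topol X) (topol Y),
       externology = {U. openin (prod_topology (topol X) (topol Y)) U \<and>
                         (\<exists>E \<in> externology X. \<exists>E' \<in> externology Y. E \<times> E' \<subseteq> U)} \<rparr>"

definition I_tr :: "real ext_space" where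
  "I_tr = \<lparr> topol = top_of_set {0..1}, externology = {{0..1}} \<rparr>"

definition exterior_homotopic ::
    "'a ext_space \<Rightarrow> 'b ext_space \<Rightarrow> ('a \<Rightarrow> 'b) \<Rightarrow> ('a \<Rightarrow> 'b) \<Rightarrow> bool" where
  "exterior_homotopic X Y f g \<longleftrightarrow>
     exterior_map X Y f \<and> exterior_map X Y g \<and>
     (\<exists>H. exterior_map (ext_prod X I_tr) Y H \<and>
          (\<forall>x \<in> topspace (topol X). H (x, 0) = f x \<and> H (x, 1) = g x))"

definition e_sectional :: "'a ext_space \<Rightarrow> 'b ext_space \<Rightarrow> ('a \<Rightarrow> 'b) \<Rightarrow> 'b set \<Rightarrow> bool" where
  "e_sectional X Y f U \<longleftrightarrow>
     openin (topol Y) U \<and>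
     (\<exists>s. exterior_map (ext_subspace Y U) X s \<and>
          exterior_homotopic (ext_subspace Y U) Y (f \<circ> s) (\<lambda>y. y))"

text \<open>The sets of the cover may repeat or be empty. The infimum of the empty set
  in \<^typ>\<open>enat\<close> is \<open>\<infinity>\<close>, and that of a nonempty set is its least element.\<close>

definition e_secat :: "'a ext_space \<Rightarrow> 'b ext_space \<Rightarrow> ('a \<Rightarrow> 'b) \<Rightarrow> enat" where
  "e_secat X Y f =
     Inf {enat k | k. \<exists>U :: nat \<Rightarrow> 'b set.
            (\<forall>i \<le> k. e_sectional X Y f (U i)) \<and> (\<Union>i \<le> k. U i) = topspace (topol Y)}"

lemma exterior_space_ext_subspace:
  assumes "exterior_space X"
  shows "exterior_space (ext_subspace X A)"
proof -
  have X: "externology X \<noteq> {}" "\<And>E. E \<in> externology X \<Longrightarrow> openin (topol X) E"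
      "\<And>E F. E \<in> externology X \<Longrightarrow> F \<in> externology X \<Longrightarrow> E \<inter> F \<in> externology X"
    using assms unfolding exterior_space_def by blast+
  obtain E0 where E0: "E0 \<in> externology X"
    using X(1) by blast
  have "openin (subtopology (topol X) A) (E0 \<inter> A)"
    unfolding openin_subtopology using X(2)[OF E0] by blast
  hence "E0 \<inter> A \<in> externology (ext_subspace X A)"
    using E0 unfolding ext_subspace_def by (simp, blast)
  hence ne: "externology (ext_subspace X A) \<noteq> {}"
    by blast
  have int: "U \<inter> V \<in> externology (ext_subspace X A)"
    if UV: "U \<in> externology (ext_subspace X A)" "V \<in> externology (ext_subspace X A)" for U V
  proof -
    obtain E F where EF: "E \<in> externology X" "F \<in> externology X" "E \<inter> A \<subseteq> U" "F \<inter> A \<subseteq> V"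
      using UV unfolding ext_subspace_def by (simp, blast)
    have "(E \<inter> F) \<inter> A \<subseteq> U \<inter> V"
      using EF by blast
    moreover have "E \<inter> F \<in> externology X"
      using EF X(3) by blast
    moreover have "openin (subtopology (topol X) A) (U \<inter> V)"
      using UV unfolding ext_subspace_def by (simp add: openin_Int)
    ultimately show ?thesis
      unfolding ext_subspace_def by (simp, blast)
  qed
  have op: "openin (topol (ext_subspace X A)) U" if "U \<in> externology (ext_subspace X A)" for U
    using that unfolding ext_subspace_def by simp
  have up: "U \<in> externology (ext_subspace X A)"
    if "V \<in> externology (ext_subspace X A)" "openin (topol (ext_subspace X A)) U" "V \<subseteq> U" for U V
    using that unfolding ext_subspace_def by (simp, blast)
  show ?thesis
    unfolding exterior_space_def using ne int op up by blast
qed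

lemma exterior_space_ext_prod:
  assumes "exterior_space X" and "exterior_space Y"
  shows "exterior_space (ext_prod X Y)"
proof -
  have X: "externology X \<noteq> {}" "\<And>E. E \<in> externology X \<Longrightarrow> openin (topol X) E"
      "\<And>E F. E \<in> externology X \<Longrightarrow> F \<in> externology X \<Longrightarrow> E \<inter> F \<in> externology X"
    using assms(1) unfolding exterior_space_def by blast+
  have Y: "externology Y \<noteq> {}" "\<And>E. E \<in> externology Y \<Longrightarrow> openin (topol Y) E"
      "\<And>E F. E \<in> externology Y \<Longrightarrow> F \<in> externology Y \<Longrightarrow> E \<inter> F \<in> externology Y"
    using assms(2) unfolding exterior_space_def by blast+
  obtain E0 F0 where EF: "E0 \<in> externology X" "F0 \<in> externology Y"
    using X(1) Y(1) by blast
  have "openin (prod_topology (topol X) (topol Y)) (E0 \<times> F0)"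
    using X(2)[OF EF(1)] Y(2)[OF EF(2)] by (simp add: openin_prod_Times_iff)
  hence "E0 \<times> F0 \<in> externology (ext_prod X Y)"
    using EF unfolding ext_prod_def by (simp, blast)
  hence ne: "externology (ext_prod X Y) \<noteq> {}"
    by blast
  have int: "U \<inter> V \<in> externology (ext_prod X Y)"
    if UV: "U \<in> externology (ext_prod X Y)" "V \<in> externology (ext_prod X Y)" for U V
  proof -
    obtain E E' where 1: "E \<in> externology X" "E' \<in> externology Y" "E \<times> E' \<subseteq> U"
      using UV(1) unfolding ext_prod_def by (simp, blast)
    obtain F F' where 2: "F \<in> externology X" "F' \<in> externology Y" "F \<times> F' \<subseteq> V"
      using UV(2) unfolding ext_prod_def by (simp, blast)
    have "E \<inter> F \<in> externology X" "E' \<inter> F' \<in> externology Y"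
      using 1 2 X(3) Y(3) by blast+
    moreover have "(E \<inter> F) \<times> (E' \<inter> F') \<subseteq> U \<inter> V"
      using 1 2 by blast
    moreover have "openin (prod_topology (topol X) (topol Y)) (U \<inter> V)"
      using UV unfolding ext_prod_def by (simp add: openin_Int)
    ultimately show ?thesis
      unfolding ext_prod_def by (simp, blast)
  qed
  have op: "openin (topol (ext_prod X Y)) U" if "U \<in> externology (ext_prod X Y)" for U
    using that unfolding ext_prod_def by simp
  have up: "U \<in> externology (ext_prod X Y)"
    if "V \<in> externology (ext_prod X Y)" "openin (topol (ext_prod X Y)) U" "V \<subseteq> U" for U V
    using that unfolding ext_prod_def by (simp, blast)
  show ?thesis
    unfolding exterior_space_def using ne int op up by blast
qed

lemma exterior_space_I_tr: "exterior_space I_tr"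
proof -
  have "U = {0..1}" if "openin (top_of_set {0..1::real}) U" "{0..1} \<subseteq> U" for U
    using that openin_imp_subset by blast
  thus ?thesis
    unfolding exterior_space_def I_tr_def by simp
qed

end

theory Submission
  imports Defs
begin

text \<open>Metrizability turns an open cover \<open>U\<^sub>0, \<dots>, U\<^sub>m\<close> of \<open>B\<close> into an increasing chain of continuous
  functions \<open>0 = \<phi>\<^sub>0 \<le> \<phi>\<^sub>1 \<le> \<dots> \<le> \<phi>\<^sub>m\<^sub>+\<^sub>1\<close> with \<open>\<phi>\<^sub>m\<^sub>+\<^sub>1 > 0\<close> such that \<open>\<phi>\<^sub>i < \<phi>\<^sub>i\<^sub>+\<^sub>1\<close> only inside \<open>U\<^sub>i\<close>;
  let \<open>\<psi>\<^sub>j\<close> be such a chain for a cover \<open>V\<^sub>0, \<dots>, V\<^sub>n\<close> of \<open>B'\<close>. The open sets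
  \<open>G\<^sub>i\<^sub>j = {(x, y). max (\<phi>\<^sub>i x) (\<psi>\<^sub>j y) < min (\<phi>\<^sub>i\<^sub>+\<^sub>1 x) (\<psi>\<^sub>j\<^sub>+\<^sub>1 y)}\<close> lie in \<open>U\<^sub>i \<times> V\<^sub>j\<close>, cover \<open>B \<times> B'\<close>,
  and are pairwise disjoint as long as \<open>i + j\<close> is fixed. Local sections and homotopies over finitely
  many disjoint open sets can be glued, and the result is exterior because externologies are closed
  under finite intersections. So the \<open>m + n + 1\<close> sets \<open>W\<^sub>k = \<Union>\<^sub>i\<^sub>+\<^sub>j\<^sub>=\<^sub>k G\<^sub>i\<^sub>j\<close> are e-sectional.\<close>

section \<open>Exterior maps\<close>

lemma topol_ext_subspace [simp]: "topol (ext_subspace X A) = subtopology (topol X) A"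
  by (simp add: ext_subspace_def)

lemma topol_ext_prod [simp]: "topol (ext_prod X Y) = prod_topology (topol X) (topol Y)"
  by (simp add: ext_prod_def)

lemma in_externology_ext_subspace:
  "U \<in> externology (ext_subspace X A) \<longleftrightarrow>
     openin (subtopology (topol X) A) U \<and> (\<exists>E \<in> externology X. E \<inter> A \<subseteq> U)"
  by (simp add: ext_subspace_def)

lemma in_externology_ext_prod:
  "U \<in> externology (ext_prod X Y) \<longleftrightarrow>
     openin (prod_topology (topol X) (topol Y)) U \<and>
     (\<exists>E \<in> externology X. \<exists>E' \<in> externology Y. E \<times> E' \<subseteq> U)"
  by (simp add: ext_prod_def)

lemma exterior_space_nonempty: "exterior_space X \<Longrightarrow> \<exists>E. E \<in> externology X"
  unfolding exterior_space_def by blast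

lemma exterior_space_openin: "\<lbrakk>exterior_space X; E \<in> externology X\<rbrakk> \<Longrightarrow> openin (topol X) E"
  unfolding exterior_space_def by blast

lemma exterior_space_subset_topspace:
  "\<lbrakk>exterior_space X; E \<in> externology X\<rbrakk> \<Longrightarrow> E \<subseteq> topspace (topol X)"
  by (meson exterior_space_openin openin_subset)

lemma exterior_space_Int:
  "\<lbrakk>exterior_space X; E \<in> externology X; F \<in> externology X\<rbrakk> \<Longrightarrow> E \<inter> F \<in> externology X"
  unfolding exterior_space_def by blast

lemma exterior_space_superset:
  "\<lbrakk>exterior_space X; E \<in> externology X; openin (topol X) U; E \<subseteq> U\<rbrakk> \<Longrightarrow> U \<in> externology X"
  unfolding exterior_space_def by blast

text \<open>Intersecting the sets one at a time stays in the externology; for empty \<open>J\<close>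
  any exterior set serves, and one exists by nonemptiness. Gluing over finitely many pieces rests on
  this.\<close>

lemma exterior_space_finite_lower_bound:
  assumes "exterior_space X" "finite J" "\<And>j. j \<in> J \<Longrightarrow> F j \<in> externology X"
  shows "\<exists>E \<in> externology X. \<forall>j \<in> J. E \<subseteq> F j"
  using assms(2,3)
proof (induction J rule: finite_induct)
  case empty
  then show ?case using exterior_space_nonempty[OF assms(1)] by blast
next
  case (insert j J)
  have "\<exists>E \<in> externology X. \<forall>j \<in> J. E \<subseteq> F j"
    by (rule insert.IH) (simp add: insert.prems)
  then obtain E where E: "E \<in> externology X" "\<forall>j \<in> J. E \<subseteq> F j" by blast
  have "E \<inter> F j \<in> externology X"
    using exterior_space_Int[OF assms(1) E(1)] insert.prems by simp
  moreover have "\<forall>i \<in> insert j J. E \<inter> F j \<subseteq> F i" using E(2) by blast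
  ultimately show ?case by (rule bexI[rotated])
qed

section \<open>Subspaces of products\<close>

lemma ext_subspace_superset:
  assumes "exterior_space X" "topspace (topol X) \<subseteq> A"
  shows "ext_subspace X A = X"
proof -
  have sub: "subtopology (topol X) A = topol X"
    using assms(2) by (rule subtopology_superset)
  have int: "E \<inter> A = E" if "E \<in> externology X" for E
    using exterior_space_subset_topspace[OF assms(1) that] assms(2) by blast
  have "U \<in> externology (ext_subspace X A) \<longleftrightarrow> U \<in> externology X" for U
    unfolding in_externology_ext_subspace sub
    using int exterior_space_openin[OF assms(1)] exterior_space_superset[OF assms(1)]
    by (metis order_refl)
  then have "externology (ext_subspace X A) = externology X"
    by blast
  then show ?thesis
    by (intro ext_space.equality) (simp_all add: sub)
qed

text \<open>Both externologies consist of the open sets containing some \<open>(E \<inter> A)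
  \<times> (F \<inter> C) = (E \<times> F) \<inter> (A \<times> C)\<close> with \<open>E\<close> and
  \<open>F\<close> exterior.\<close>

lemma ext_prod_ext_subspace:
  assumes "exterior_space X" "exterior_space Y"
  shows "ext_prod (ext_subspace X A) (ext_subspace Y C) = ext_subspace (ext_prod X Y) (A \<times> C)"
proof -
  have "U \<in> externology (ext_prod (ext_subspace X A) (ext_subspace Y C)) \<longleftrightarrow>
        U \<in> externology (ext_subspace (ext_prod X Y) (A \<times> C))" for U
  proof -
    have "(\<exists>E \<in> externology (ext_subspace X A). \<exists>F \<in> externology (ext_subspace Y C). E \<times> F \<subseteq> U) \<longleftrightarrow>
          (\<exists>P \<in> externology (ext_prod X Y). P \<inter> A \<times> C \<subseteq> U)" (is "?L \<longleftrightarrow> ?R")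
    proof
      assume ?L
      then obtain P Q where PQ: "P \<in> externology (ext_subspace X A)" "Q \<in> externology (ext_subspace Y C)"
        "P \<times> Q \<subseteq> U"
        by blast
      obtain E F where EF: "E \<in> externology X" "F \<in> externology Y" "E \<inter> A \<subseteq> P" "F \<inter> C \<subseteq> Q"
        using PQ(1,2) unfolding in_externology_ext_subspace by blast
      have "E \<times> F \<in> externology (ext_prod X Y)"
        unfolding in_externology_ext_prod openin_prod_Times_iff
        using EF(1,2) exterior_space_openin[OF assms(1)] exterior_space_openin[OF assms(2)] by blast
      moreover have "E \<times> F \<inter> A \<times> C \<subseteq> U"
        using EF(3,4) PQ(3) by blast
      ultimately show ?R by blast
    next
      assume ?R
      then obtain P where P: "P \<in> externology (ext_prod X Y)" "P \<inter> A \<times> C \<subseteq> U"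
        by blast
      obtain E F where EF: "E \<in> externology X" "F \<in> externology Y" "E \<times> F \<subseteq> P"
        using P(1) unfolding in_externology_ext_prod by blast
      have "E \<inter> A \<in> externology (ext_subspace X A)" "F \<inter> C \<in> externology (ext_subspace Y C)"
        unfolding in_externology_ext_subspace openin_subtopology
        using EF(1,2) exterior_space_openin[OF assms(1)] exterior_space_openin[OF assms(2)] by blast+
      moreover have "(E \<inter> A) \<times> (F \<inter> C) \<subseteq> U"
        using EF(3) P(2) by blast
      ultimately show ?L by blast
    qed
    then show ?thesis
      by (simp add: in_externology_ext_prod[of U "ext_subspace X A"] subtopology_Times
          in_externology_ext_subspace[of U "ext_prod X Y"])
  qed
  then have "externology (ext_prod (ext_subspace X A) (ext_subspace Y C)) =
             externology (ext_subspace (ext_prod X Y) (A \<times> C))"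
    by blast
  then show ?thesis by (intro ext_space.equality) (auto simp: subtopology_Times)
qed

text \<open>Turns a cylinder over a subspace into a subspace of the cylinder, so that restriction of
  maps on subspaces applies to homotopies too. Here \<open>I_tr\<close> is viewed as its own
  subspace on \<open>UNIV\<close>.\<close>

lemma ext_prod_ext_subspace_I_tr:
  assumes "exterior_space X"
  shows "ext_prod (ext_subspace X A) I_tr = ext_subspace (ext_prod X I_tr) (A \<times> UNIV)"
  using ext_prod_ext_subspace[OF assms exterior_space_I_tr, of A UNIV]
  by (simp add: ext_subspace_superset[OF exterior_space_I_tr])

section \<open>Composition, projections and pairing\<close>

lemma exterior_map_cong:
  assumes "exterior_map X Y f" "\<And>x. x \<in> topspace (topol X) \<Longrightarrow> f x = g x"
  shows "exterior_map X Y g"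
proof -
  have "{x \<in> topspace (topol X). g x \<in> E} = {x \<in> topspace (topol X). f x \<in> E}" for E
    using assms(2) by auto
  then show ?thesis
    using assms continuous_map_eq[of "topol X" "topol Y" f g] unfolding exterior_map_def by auto
qed

lemma exterior_map_compose:
  assumes "exterior_map X Y f" "exterior_map Y Z g"
  shows "exterior_map X Z (\<lambda>x. g (f x))"
proof -
  have "{x \<in> topspace (topol X). g (f x) \<in> E} \<in> externology X" if E: "E \<in> externology Z" for E
  proof -
    have eq: "{x \<in> topspace (topol X). g (f x) \<in> E} =
          {x \<in> topspace (topol X). f x \<in> {y \<in> topspace (topol Y). g y \<in> E}}"
      using assms(1) by (auto simp: exterior_map_def continuous_map_def)
    have "{y \<in> topspace (topol Y). g y \<in> E} \<in> externology Y"
      using assms(2) E by (simp add: exterior_map_def)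
    then show ?thesis
      using assms(1) unfolding eq exterior_map_def by blast
  qed
  moreover have "continuous_map (topol X) (topol Z) (\<lambda>x. g (f x))"
    using continuous_map_compose[of "topol X" "topol Y" f "topol Z" g] assms
    unfolding exterior_map_def o_def by blast
  ultimately show ?thesis by (simp add: exterior_map_def)
qed

text \<open>The preimage of \<open>E\<close> is \<open>E \<times> topspace (topol Y)\<close>, which
  contains \<open>E \<times> F\<close> for any exterior \<open>F\<close>; such an \<open>F\<close>
  exists because externologies are nonempty.\<close>

lemma exterior_map_fst:
  assumes "exterior_space X" "exterior_space Y"
  shows "exterior_map (ext_prod X Y) X fst"
proof -
  have "{z \<in> topspace (topol (ext_prod X Y)). fst z \<in> E} \<in> externology (ext_prod X Y)"
    if E: "E \<in> externology X" for E
  proof -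
    obtain F where F: "F \<in> externology Y" using exterior_space_nonempty assms(2) by blast
    have eq: "{z \<in> topspace (topol (ext_prod X Y)). fst z \<in> E} = E \<times> topspace (topol Y)"
      using exterior_space_subset_topspace[OF assms(1) E] by auto
    show ?thesis
      unfolding eq using E F exterior_space_openin[OF assms(1) E]
        exterior_space_subset_topspace[OF assms(2) F]
      by (auto simp: in_externology_ext_prod openin_prod_Times_iff)
  qed
  then show ?thesis by (simp add: exterior_map_def continuous_map_fst)
qed

lemma exterior_map_snd:
  assumes "exterior_space X" "exterior_space Y"
  shows "exterior_map (ext_prod X Y) Y snd"
proof -
  have "{z \<in> topspace (topol (ext_prod X Y)). snd z \<in> F} \<in> externology (ext_prod X Y)"
    if F: "F \<in> externology Y" for F
  proof -
    obtain E where E: "E \<in> externology X" using exterior_space_nonempty assms(1) by blast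
    have eq: "{z \<in> topspace (topol (ext_prod X Y)). snd z \<in> F} = topspace (topol X) \<times> F"
      using exterior_space_subset_topspace[OF assms(2) F] by auto
    show ?thesis
      unfolding eq using E F exterior_space_openin[OF assms(2) F]
        exterior_space_subset_topspace[OF assms(1) E]
      by (auto simp: in_externology_ext_prod openin_prod_Times_iff)
  qed
  then show ?thesis by (simp add: exterior_map_def continuous_map_snd)
qed

text \<open>If \<open>P\<close> contains \<open>E \<times> F\<close>, its preimage contains the
  intersection of the preimages of \<open>E\<close> under \<open>p\<close> and of \<open>F\<close>
  under \<open>q\<close>. That intersection is exterior, and the preimage of \<open>P\<close> is
  open, so upward closure applies.\<close>

lemma exterior_map_pair:
  assumes "exterior_space Z" "exterior_map Z X p" "exterior_map Z Y q"
  shows "exterior_map Z (ext_prod X Y) (\<lambda>z. (p z, q z))"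
proof -
  have cont: "continuous_map (topol Z) (prod_topology (topol X) (topol Y)) (\<lambda>z. (p z, q z))"
    using assms(2,3) by (simp add: exterior_map_def continuous_map_pairwise o_def)
  have "{z \<in> topspace (topol Z). (p z, q z) \<in> P} \<in> externology Z"
    if P: "P \<in> externology (ext_prod X Y)" for P
  proof -
    obtain E F where EF: "E \<in> externology X" "F \<in> externology Y" "E \<times> F \<subseteq> P"
      and op: "openin (prod_topology (topol X) (topol Y)) P"
      using P by (auto simp: in_externology_ext_prod)
    have "{z \<in> topspace (topol Z). p z \<in> E} \<inter> {z \<in> topspace (topol Z). q z \<in> F} \<in> externology Z"
      using exterior_space_Int[OF assms(1)] assms(2,3) EF(1,2) by (simp add: exterior_map_def)
    moreover have "openin (topol Z) {z \<in> topspace (topol Z). (p z, q z) \<in> P}"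
      using openin_continuous_map_preimage[OF cont op] .
    ultimately show ?thesis
      using EF(3) by (elim exterior_space_superset[OF assms(1)]) auto
  qed
  then show ?thesis using cont by (simp add: exterior_map_def)
qed

lemma exterior_map_map_prod:
  assumes "exterior_space X" "exterior_space Y" "exterior_map X X' f" "exterior_map Y Y' g"
  shows "exterior_map (ext_prod X Y) (ext_prod X' Y') (map_prod f g)"
proof -
  have "exterior_map (ext_prod X Y) (ext_prod X' Y') (\<lambda>z. (f (fst z), g (snd z)))"
    using exterior_map_compose[OF exterior_map_fst[OF assms(1,2)] assms(3)]
      exterior_map_compose[OF exterior_map_snd[OF assms(1,2)] assms(4)]
    by (rule exterior_map_pair[OF exterior_space_ext_prod[OF assms(1,2)]])
  then show ?thesis by (simp add: map_prod_def split_beta')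
qed

section \<open>Restriction and gluing\<close>

lemma exterior_map_ext_subspace_mono:
  assumes "exterior_map (ext_subspace Y U) X h" "V \<subseteq> U"
  shows "exterior_map (ext_subspace Y V) X h"
proof -
  have cont: "continuous_map (subtopology (topol Y) V) (topol X) h"
    using assms(1) continuous_map_from_subtopology_mono[OF _ assms(2)]
    unfolding exterior_map_def topol_ext_subspace by blast
  have "{y \<in> topspace (subtopology (topol Y) V). h y \<in> E} \<in> externology (ext_subspace Y V)"
    if E: "E \<in> externology X" for E
  proof -
    let ?P = "\<lambda>A. {y \<in> topspace (subtopology (topol Y) A). h y \<in> E}"
    have "?P U \<in> externology (ext_subspace Y U)"
      using assms(1) E by (simp add: exterior_map_def)
    \<comment> \<open>The exterior set \<open>F\<close> and the open set \<open>O1\<close> found for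
      \<open>U\<close> also serve for \<open>V\<close>, since the preimage over \<open>V\<close> is
      the preimage over \<open>U\<close> cut down to \<open>V\<close>.\<close>
    then obtain F O1 where F: "F \<in> externology Y" "F \<inter> U \<subseteq> ?P U"
      and O1: "openin (topol Y) O1" "?P U = O1 \<inter> U"
      unfolding in_externology_ext_subspace openin_subtopology by blast
    have eq: "?P V = ?P U \<inter> V" using assms(2) by auto
    have "?P V = O1 \<inter> V" unfolding eq O1(2) using assms(2) by blast
    then have "openin (subtopology (topol Y) V) (?P V)"
      using O1(1) unfolding openin_subtopology by blast
    moreover have "F \<inter> V \<subseteq> ?P V" unfolding eq using F(2) assms(2) by blast
    ultimately show ?thesis
      using F(1) unfolding in_externology_ext_subspace by blast
  qed
  then show ?thesis using cont by (simp add: exterior_map_def)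
qed

text \<open>Continuity is local on open pieces. For exteriority each piece supplies its own exterior
  set \<open>F j\<close>; finiteness of \<open>J\<close> gives one exterior \<open>D\<close> below
  them all, and the trace of \<open>D\<close> on the union lies in the preimage.\<close>

lemma exterior_map_ext_subspace_UN:
  assumes Y: "exterior_space Y" and J: "finite J"
    and G: "\<And>j. j \<in> J \<Longrightarrow> openin (topol Y) (G j)"
    and h: "\<And>j. j \<in> J \<Longrightarrow> exterior_map (ext_subspace Y (G j)) X h"
  shows "exterior_map (ext_subspace Y (\<Union>j\<in>J. G j)) X h"
proof -
  let ?W = "\<Union>j\<in>J. G j"
  have cont: "continuous_map (subtopology (topol Y) ?W) (topol X) h"
  proof (rule pasting_lemma[where I = J and T = G and f = "\<lambda>_. h"])
    fix j assume j: "j \<in> J"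
    show "openin (subtopology (topol Y) ?W) (G j)"
      using G[OF j] j by (auto simp: openin_subtopology)
    have "?W \<inter> G j = G j" using j by auto
    then show "continuous_map (subtopology (subtopology (topol Y) ?W) (G j)) (topol X) h"
      using h[OF j] by (simp add: subtopology_subtopology exterior_map_def)
  qed auto
  have "{y \<in> topspace (subtopology (topol Y) ?W). h y \<in> E} \<in> externology (ext_subspace Y ?W)"
    if E: "E \<in> externology X" for E
  proof -
    let ?P = "\<lambda>A. {y \<in> topspace (subtopology (topol Y) A). h y \<in> E}"
    have P: "?P (G j) \<in> externology (ext_subspace Y (G j))" if "j \<in> J" for j
      using h[OF that] E by (simp add: exterior_map_def)
    have "\<exists>F. \<forall>j \<in> J. F j \<in> externology Y \<and> F j \<inter> G j \<subseteq> ?P (G j)"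
      using P unfolding in_externology_ext_subspace by (intro bchoice) blast
    then obtain F where F: "\<And>j. j \<in> J \<Longrightarrow> F j \<in> externology Y"
      "\<And>j. j \<in> J \<Longrightarrow> F j \<inter> G j \<subseteq> ?P (G j)"
      by blast
    obtain D where D: "D \<in> externology Y" "\<forall>j \<in> J. D \<subseteq> F j"
      using exterior_space_finite_lower_bound[OF Y J, of F] F(1) by blast
    have eq: "?P ?W = (\<Union>j\<in>J. ?P (G j))" by auto
    have "openin (topol Y) (?P (G j))" if "j \<in> J" for j
      using P[OF that] G[OF that] by (meson in_externology_ext_subspace openin_trans_full)
    then have "openin (topol Y) (?P ?W)" unfolding eq by blast
    then have "openin (subtopology (topol Y) ?W) (?P ?W)"
      by (rule subset_openin_subtopology) auto
    moreover have "D \<inter> ?W \<subseteq> ?P ?W"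
      unfolding eq using D(2) F(2) by blast
    ultimately show ?thesis using D(1) by (auto simp: in_externology_ext_subspace)
  qed
  then show ?thesis using cont by (simp add: exterior_map_def)
qed

section \<open>E-sectional sets\<close>

lemma e_sectional_subset:
  assumes "exterior_space Y" "e_sectional X Y f U" "openin (topol Y) V" "V \<subseteq> U"
  shows "e_sectional X Y f V"
proof -
  note prod = ext_prod_ext_subspace_I_tr[OF assms(1)]
  have sub: "V \<times> (UNIV :: real set) \<subseteq> U \<times> UNIV" using assms(4) by auto
  obtain s H where s: "exterior_map (ext_subspace Y U) X s" "exterior_map (ext_subspace Y U) Y (f \<circ> s)"
    "exterior_map (ext_subspace Y U) Y (\<lambda>y. y)"
    and H: "exterior_map (ext_subspace (ext_prod Y I_tr) (U \<times> UNIV)) Y H"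
    and H01: "\<forall>y \<in> topspace (topol (ext_subspace Y U)). H (y, 0) = (f \<circ> s) y \<and> H (y, 1) = y"
    using assms(2) unfolding e_sectional_def exterior_homotopic_def prod by blast
  have "\<forall>y \<in> topspace (topol (ext_subspace Y V)). H (y, 0) = (f \<circ> s) y \<and> H (y, 1) = y"
    using H01 assms(4) by auto
  then show ?thesis
    unfolding e_sectional_def exterior_homotopic_def prod
    using assms(3) s[THEN exterior_map_ext_subspace_mono[OF _ assms(4)]]
      exterior_map_ext_subspace_mono[OF H sub] by blast
qed

text \<open>Sections and homotopies chosen piece by piece fit together because no two pieces meet;
  finiteness of \<open>J\<close> keeps the glued maps exterior.\<close>

lemma e_sectional_UN:
  assumes Y: "exterior_space Y" and J: "finite J"
    and G: "\<And>j. j \<in> J \<Longrightarrow> e_sectional X Y f (G j)"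
    and disj: "disjoint_family_on G J"
  shows "e_sectional X Y f (\<Union>j\<in>J. G j)"
proof -
  let ?W = "\<Union>j\<in>J. G j"
  note prod = ext_prod_ext_subspace_I_tr[OF Y]
  have op: "openin (topol Y) (G j)" if "j \<in> J" for j
    using G[OF that] by (simp add: e_sectional_def)
  have "\<exists>s. \<forall>j \<in> J. exterior_map (ext_subspace Y (G j)) X (s j) \<and>
          exterior_homotopic (ext_subspace Y (G j)) Y (f \<circ> s j) (\<lambda>y. y)"
    using G unfolding e_sectional_def by (intro bchoice) blast
  then obtain s where s: "\<And>j. j \<in> J \<Longrightarrow> exterior_map (ext_subspace Y (G j)) X (s j)"
    and hom: "\<And>j. j \<in> J \<Longrightarrow> exterior_homotopic (ext_subspace Y (G j)) Y (f \<circ> s j) (\<lambda>y. y)"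
    by blast
  have "\<exists>H. \<forall>j \<in> J. exterior_map (ext_prod (ext_subspace Y (G j)) I_tr) Y (H j) \<and>
          (\<forall>y \<in> topspace (topol (ext_subspace Y (G j))). H j (y, 0) = (f \<circ> s j) y \<and> H j (y, 1) = y)"
    using hom unfolding exterior_homotopic_def by (intro bchoice) blast
  then obtain H where H: "\<And>j. j \<in> J \<Longrightarrow> exterior_map (ext_prod (ext_subspace Y (G j)) I_tr) Y (H j)"
    and H01: "\<And>j y. \<lbrakk>j \<in> J; y \<in> topspace (topol Y); y \<in> G j\<rbrakk> \<Longrightarrow> H j (y, 0) = f (s j y) \<and> H j (y, 1) = y"
    by fastforce
  \<comment> \<open>The index of the piece containing \<open>y\<close>, unique by disjointness. Its
    value outside the union is unspecified and never matters.\<close>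
  define idx where "idx y = (THE j. j \<in> J \<and> y \<in> G j)" for y
  have idx: "idx y = j" if "j \<in> J" "y \<in> G j" for j y
    unfolding idx_def using that disj by (intro the_equality) (auto simp: disjoint_family_on_def)
  define S where "S y = s (idx y) y" for y
  define K where "K z = H (idx (fst z)) z" for z
  have "exterior_map (ext_subspace Y ?W) X S"
  proof (rule exterior_map_ext_subspace_UN[OF Y J op])
    show "exterior_map (ext_subspace Y (G j)) X S" if "j \<in> J" for j
      by (rule exterior_map_cong[OF s[OF that]]) (use that idx in \<open>auto simp: S_def\<close>)
  qed
  moreover have "exterior_map (ext_subspace Y ?W) Y (f \<circ> S)"
  proof (rule exterior_map_ext_subspace_UN[OF Y J op])
    fix j assume j: "j \<in> J"
    have "exterior_map (ext_subspace Y (G j)) Y (f \<circ> s j)"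
      using hom[OF j] by (simp add: exterior_homotopic_def)
    then show "exterior_map (ext_subspace Y (G j)) Y (f \<circ> S)"
      by (rule exterior_map_cong) (use j idx in \<open>auto simp: S_def\<close>)
  qed
  moreover have "exterior_map (ext_subspace Y ?W) Y (\<lambda>y. y)"
    using hom by (intro exterior_map_ext_subspace_UN[OF Y J op]) (auto simp: exterior_homotopic_def)
  moreover have "exterior_map (ext_prod (ext_subspace Y ?W) I_tr) Y K"
  proof -
    \<comment> \<open>The pieces are cylinders over \<open>topspace (topol I_tr)\<close> instead of
      \<open>UNIV\<close>: gluing asks for open pieces, and \<open>G j \<times> UNIV\<close> is not
      open in the product unless \<open>G j\<close> is empty.\<close>
    have "exterior_map (ext_subspace (ext_prod Y I_tr) (\<Union>j\<in>J. G j \<times> topspace (topol I_tr))) Y K"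
    proof (rule exterior_map_ext_subspace_UN[OF exterior_space_ext_prod[OF Y exterior_space_I_tr] J])
      fix j assume j: "j \<in> J"
      show "openin (topol (ext_prod Y I_tr)) (G j \<times> topspace (topol I_tr))"
        using op[OF j] by (simp add: openin_prod_Times_iff)
      have "exterior_map (ext_subspace (ext_prod Y I_tr) (G j \<times> topspace (topol I_tr))) Y (H j)"
        using H[OF j] unfolding prod by (rule exterior_map_ext_subspace_mono) auto
      then show "exterior_map (ext_subspace (ext_prod Y I_tr) (G j \<times> topspace (topol I_tr))) Y K"
        by (rule exterior_map_cong) (use j idx in \<open>auto simp: K_def\<close>)
    qed
    moreover have "ext_subspace (ext_prod Y I_tr) (\<Union>j\<in>J. G j \<times> topspace (topol I_tr)) =
                   ext_prod (ext_subspace Y ?W) I_tr"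
    proof -
      have "ext_subspace I_tr (topspace (topol I_tr)) = I_tr"
        by (rule ext_subspace_superset[OF exterior_space_I_tr]) simp
      then show ?thesis
        using ext_prod_ext_subspace[OF Y exterior_space_I_tr, of ?W "topspace (topol I_tr)"]
        by (simp add: Sigma_Union)
    qed
    ultimately show ?thesis by simp
  qed
  moreover have "K (y, 0) = (f \<circ> S) y \<and> K (y, 1) = y"
    if "y \<in> topspace (topol (ext_subspace Y ?W))" for y
    using that H01 idx by (auto simp: K_def S_def)
  ultimately show ?thesis
    unfolding e_sectional_def exterior_homotopic_def using op by blast
qed

lemma e_sectional_Times:
  assumes "exterior_space Y" "exterior_space Y'"
    and "e_sectional X Y f U" "e_sectional X' Y' g V"
  shows "e_sectional (ext_prod X X') (ext_prod Y Y') (map_prod f g) (U \<times> V)"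
proof -
  let ?U = "ext_subspace Y U" and ?V = "ext_subspace Y' V"
  obtain s H where s: "exterior_map ?U X s" and fs: "exterior_map ?U Y (f \<circ> s)"
    and iU: "exterior_map ?U Y (\<lambda>y. y)" and H: "exterior_map (ext_prod ?U I_tr) Y H"
    and H01: "\<forall>x \<in> topspace (topol ?U). H (x, 0) = (f \<circ> s) x \<and> H (x, 1) = x"
    using assms(3) unfolding e_sectional_def exterior_homotopic_def by blast
  obtain t K where t: "exterior_map ?V X' t" and gt: "exterior_map ?V Y' (g \<circ> t)"
    and iV: "exterior_map ?V Y' (\<lambda>y. y)" and K: "exterior_map (ext_prod ?V I_tr) Y' K"
    and K01: "\<forall>x \<in> topspace (topol ?V). K (x, 0) = (g \<circ> t) x \<and> K (x, 1) = x"
    using assms(4) unfolding e_sectional_def exterior_homotopic_def by blast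
  have sp: "exterior_space ?U" "exterior_space ?V" "exterior_space (ext_prod ?U ?V)"
    "exterior_space (ext_prod (ext_prod ?U ?V) I_tr)"
    using assms(1,2) by (simp_all add: exterior_space_ext_subspace exterior_space_ext_prod exterior_space_I_tr)
  have UV: "ext_subspace (ext_prod Y Y') (U \<times> V) = ext_prod ?U ?V"
    using ext_prod_ext_subspace[OF assms(1,2)] by simp
  have "exterior_map (ext_prod ?U ?V) (ext_prod Y Y') (map_prod f g \<circ> map_prod s t)"
    using exterior_map_map_prod[OF sp(1,2) fs gt] by (simp add: map_prod_compose)
  moreover have "exterior_map (ext_prod ?U ?V) (ext_prod Y Y') (\<lambda>z. z)"
    using exterior_map_map_prod[OF sp(1,2) iU iV] by (simp add: map_prod_def)
  \<comment> \<open>The two homotopies run simultaneously: the same time coordinate is fed to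
    \<open>H\<close> and to \<open>K\<close>.\<close>
  moreover have "exterior_map (ext_prod (ext_prod ?U ?V) I_tr) (ext_prod Y Y')
      (\<lambda>z. (H (fst (fst z), snd z), K (snd (fst z), snd z)))"
    by (intro exterior_map_pair sp exterior_map_compose[OF _ H] exterior_map_compose[OF _ K]
        exterior_map_compose[OF exterior_map_fst exterior_map_fst]
        exterior_map_compose[OF exterior_map_fst exterior_map_snd]
        exterior_map_snd exterior_space_I_tr)
  moreover have "openin (topol (ext_prod Y Y')) (U \<times> V)"
    using assms(3,4) by (simp add: e_sectional_def openin_prod_Times_iff)
  ultimately show ?thesis
    unfolding e_sectional_def exterior_homotopic_def UV
    using exterior_map_map_prod[OF sp(1,2) s t] H01 K01
    by (intro conjI exI[of _ "map_prod s t"]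
          exI[of _ "\<lambda>z. (H (fst (fst z), snd z), K (snd (fst z), snd z))"]) auto
qed

section \<open>Covers of a product\<close>

text \<open>The function is the distance to the complement of \<open>U\<close>, truncated at 1;
  openness of \<open>U\<close> makes it positive at each point of \<open>U\<close>.\<close>

lemma metrizable_space_open_eq_positive_set:
  assumes "metrizable_space X" "openin X U"
  obtains u where "continuous_map X euclideanreal u"
    "\<And>x. x \<in> topspace X \<Longrightarrow> 0 \<le> u x" "\<And>x. x \<in> topspace X \<Longrightarrow> 0 < u x \<longleftrightarrow> x \<in> U"
proof -
  obtain M d where M: "Metric_space M d" and X: "X = Metric_space.mtopology M d"
    using assms(1) by (auto simp: metrizable_space_def)
  interpret Metric_space M d by (fact M)
  \<comment> \<open>Inserting 1 keeps the infimum over a nonempty set even when \<open>U\<close> is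
    the whole space.\<close>
  define u where "u x = Inf (insert 1 (d x ` (M - U)))" for x
  have bdd: "bdd_below (insert 1 (d x ` (M - U)))" for x
    by (intro bdd_belowI[of _ 0]) auto
  have le: "u x \<le> 1" "y \<in> M - U \<Longrightarrow> u x \<le> d x y" for x y
    unfolding u_def by (auto intro!: cInf_lower bdd)
  have ge: "c \<le> u x" if "c \<le> 1" "\<And>y. y \<in> M - U \<Longrightarrow> c \<le> d x y" for c x
    unfolding u_def using that by (intro cInf_greatest) auto
  \<comment> \<open>The function is 1-Lipschitz, so its strict superlevel and sublevel sets are
    open; these two facts together are continuity.\<close>
  have lip: "u x \<le> u y + d x y" if "x \<in> M" "y \<in> M" for x y
  proof -
    have "u x - d x y \<le> u y"
    proof (rule ge)
      show "u x - d x y \<le> 1" using le(1)[of x] nonneg[of x y] by linarith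
      fix z assume z: "z \<in> M - U"
      then show "u x - d x y \<le> d y z"
        using le(2)[OF z, of x] triangle[of x y z] that by auto
    qed
    then show ?thesis by simp
  qed
  have "openin mtopology {x \<in> M. a < u x}" for a
    unfolding openin_mtopology
  proof (intro conjI allI impI)
    fix x assume x: "x \<in> {x \<in> M. a < u x}"
    have "a < u y" if "y \<in> M" "d x y < u x - a" for y
      using lip[of x y] that x by auto
    then show "\<exists>r>0. mball x r \<subseteq> {x \<in> M. a < u x}"
      using x by (intro exI[of _ "u x - a"]) auto
  qed auto
  moreover have "openin mtopology {x \<in> M. u x < a}" for a
    unfolding openin_mtopology
  proof (intro conjI allI impI)
    fix x assume x: "x \<in> {x \<in> M. u x < a}"
    have "u y < a" if "y \<in> M" "d x y < a - u x" for y
      using lip[of y x] that x commute[of x y] by auto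
    then show "\<exists>r>0. mball x r \<subseteq> {x \<in> M. u x < a}"
      using x by (intro exI[of _ "a - u x"]) auto
  qed auto
  ultimately have "continuous_map X euclideanreal u"
    by (simp add: X continuous_map_upper_lower_semicontinuous_lt)
  moreover have "0 \<le> u x" for x
    by (rule ge) auto
  moreover have "0 < u x \<longleftrightarrow> x \<in> U" if x: "x \<in> M" for x
  proof
    show "x \<in> U" if "0 < u x"
      using le(2)[of x x] x that by fastforce
    assume "x \<in> U"
    then obtain r where r: "r > 0" "mball x r \<subseteq> U"
      using assms(2) unfolding X openin_mtopology by blast
    have "min 1 r \<le> u x"
    proof (rule ge)
      fix y assume "y \<in> M - U"
      then show "min 1 r \<le> d x y" using r(2) x by (force simp: subset_iff)
    qed simp
    then show "0 < u x" using r(1) by linarith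
  qed
  ultimately show ?thesis using that by (simp add: X)
qed

text \<open>The chain is a running maximum of functions \<open>u k\<close> positive exactly on
  \<open>U k\<close>. Growth at step \<open>i\<close> forces
  \<open>u i x > \<phi> i x \<ge> 0\<close>, hence \<open>x \<in> U i\<close>.\<close>

lemma metrizable_space_cover_chain:
  fixes U :: "nat \<Rightarrow> 'a set"
  assumes "metrizable_space X" "\<And>i. i \<le> m \<Longrightarrow> openin X (U i)" "(\<Union>i\<le>m. U i) = topspace X"
  obtains \<phi> :: "nat \<Rightarrow> 'a \<Rightarrow> real" where
    "\<And>i. i \<le> Suc m \<Longrightarrow> continuous_map X euclideanreal (\<phi> i)"
    "\<And>x i j. i \<le> j \<Longrightarrow> \<phi> i x \<le> \<phi> j x"
    "\<And>x i. \<lbrakk>i \<le> m; x \<in> topspace X; \<phi> i x < \<phi> (Suc i) x\<rbrakk> \<Longrightarrow> x \<in> U i"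
    "\<And>x. x \<in> topspace X \<Longrightarrow> \<exists>i\<le>m. \<phi> i x = 0 \<and> 0 < \<phi> (Suc i) x"
proof -
  have "\<exists>u. \<forall>i \<in> {..m}. continuous_map X euclideanreal (u i) \<and>
          (\<forall>x \<in> topspace X. 0 \<le> u i x \<and> (0 < u i x \<longleftrightarrow> x \<in> U i))"
    using metrizable_space_open_eq_positive_set[OF assms(1) assms(2)]
    by (intro bchoice) (metis atMost_iff)
  then obtain u where u: "\<And>i. i \<le> m \<Longrightarrow> continuous_map X euclideanreal (u i)"
    "\<And>i x. \<lbrakk>i \<le> m; x \<in> topspace X\<rbrakk> \<Longrightarrow> 0 < u i x \<longleftrightarrow> x \<in> U i"
    by auto
  \<comment> \<open>Started at 0, \<open>\<phi> i\<close> is the maximum of 0 and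
    \<open>u 0, ..., u (i - 1)\<close>. As \<open>u k\<close> is controlled only for
    \<open>k \<le> m\<close>, continuity stops at \<open>Suc m\<close>.\<close>
  define \<phi> where "\<phi> i x = rec_nat 0 (\<lambda>k r. max r (u k x)) i" for i x
  have \<phi>_0: "\<phi> 0 x = 0" and \<phi>_Suc: "\<phi> (Suc i) x = max (\<phi> i x) (u i x)" for i x
    by (simp_all add: \<phi>_def)
  have mono: "\<phi> i x \<le> \<phi> j x" if "i \<le> j" for i j x
    by (rule lift_Suc_mono_le[OF _ that]) (simp add: \<phi>_Suc)
  have nonneg: "0 \<le> \<phi> i x" for i x
    using mono[of 0 i x] by (simp add: \<phi>_0)
  have cont: "continuous_map X euclideanreal (\<phi> i)" if "i \<le> Suc m" for i
    using that
  proof (induction i)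
    case 0
    then show ?case by (simp add: \<phi>_0[abs_def])
  next
    case (Suc i)
    then show ?case using continuous_map_real_max[OF Suc.IH u(1)] by (simp add: \<phi>_Suc[abs_def])
  qed
  have sub: "x \<in> U i" if "i \<le> m" "x \<in> topspace X" "\<phi> i x < \<phi> (Suc i) x" for i x
    using that u(2)[OF that(1,2)] nonneg[of i x] by (auto simp: \<phi>_Suc)
  have "\<exists>i\<le>m. \<phi> i x = 0 \<and> 0 < \<phi> (Suc i) x" if x: "x \<in> topspace X" for x
  proof -
    obtain k where k: "k \<le> m" "x \<in> U k" using x assms(3) by blast
    then have pos: "0 < \<phi> (Suc k) x" using u(2)[OF k(1) x] by (auto simp: \<phi>_Suc)
    \<comment> \<open>The first step at which the running maximum becomes positive; before it the
      value is 0, by minimality or, for \<open>i = 0\<close>, as the starting value.\<close>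
    define i where "i = (LEAST i. 0 < \<phi> (Suc i) x)"
    have i: "0 < \<phi> (Suc i) x" unfolding i_def using pos by (rule LeastI)
    have "i \<le> k" unfolding i_def using pos by (rule Least_le)
    have "\<phi> i x = 0"
    proof (cases i)
      case (Suc l)
      then have "\<not> 0 < \<phi> i x"
        using not_less_Least[of l "\<lambda>i. 0 < \<phi> (Suc i) x"] by (simp flip: i_def)
      then show ?thesis using nonneg[of i x] by linarith
    qed (simp add: \<phi>_0)
    then show ?thesis using i le_trans[OF \<open>i \<le> k\<close> k(1)] by blast
  qed
  with cont mono sub show ?thesis by (rule that)
qed

text \<open>A point lies in \<open>G (i, j)\<close> when the open intervals
  \<open>(\<phi>\<^sub>i x, \<phi>\<^sub>i\<^sub>+\<^sub>1 x)\<close> and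
  \<open>(\<psi>\<^sub>j y, \<psi>\<^sub>j\<^sub>+\<^sub>1 y)\<close> overlap. Both are then
  nonempty, which puts \<open>x\<close> in \<open>U i\<close> and \<open>y\<close> in
  \<open>V j\<close>. Along an antidiagonal one interval moves up while the other moves down, so two
  overlaps are impossible.\<close>

lemma metrizable_space_product_cover:
  fixes U :: "nat \<Rightarrow> 'a set" and V :: "nat \<Rightarrow> 'b set"
  assumes "metrizable_space X" "\<And>i. i \<le> m \<Longrightarrow> openin X (U i)" "(\<Union>i\<le>m. U i) = topspace X"
    and "metrizable_space Y" "\<And>j. j \<le> n \<Longrightarrow> openin Y (V j)" "(\<Union>j\<le>n. V j) = topspace Y"
  obtains G :: "nat \<times> nat \<Rightarrow> ('a \<times> 'b) set" where
    "\<And>i j. \<lbrakk>i \<le> m; j \<le> n\<rbrakk> \<Longrightarrow> openin (prod_topology X Y) (G (i, j))"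
    "\<And>i j. \<lbrakk>i \<le> m; j \<le> n\<rbrakk> \<Longrightarrow> G (i, j) \<subseteq> U i \<times> V j"
    "\<And>k. disjoint_family_on G {p. fst p + snd p = k}"
    "(\<Union>p\<in>{..m} \<times> {..n}. G p) = topspace X \<times> topspace Y"
proof -
  obtain \<phi> :: "nat \<Rightarrow> 'a \<Rightarrow> real" where
    \<phi>: "\<And>i. i \<le> Suc m \<Longrightarrow> continuous_map X euclideanreal (\<phi> i)"
      "\<And>x i j. i \<le> j \<Longrightarrow> \<phi> i x \<le> \<phi> j x"
      "\<And>x i. \<lbrakk>i \<le> m; x \<in> topspace X; \<phi> i x < \<phi> (Suc i) x\<rbrakk> \<Longrightarrow> x \<in> U i"
      "\<And>x. x \<in> topspace X \<Longrightarrow> \<exists>i\<le>m. \<phi> i x = 0 \<and> 0 < \<phi> (Suc i) x"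
    using metrizable_space_cover_chain[OF assms(1-3)] by blast
  obtain \<psi> :: "nat \<Rightarrow> 'b \<Rightarrow> real" where
    \<psi>: "\<And>j. j \<le> Suc n \<Longrightarrow> continuous_map Y euclideanreal (\<psi> j)"
      "\<And>y i j. i \<le> j \<Longrightarrow> \<psi> i y \<le> \<psi> j y"
      "\<And>y j. \<lbrakk>j \<le> n; y \<in> topspace Y; \<psi> j y < \<psi> (Suc j) y\<rbrakk> \<Longrightarrow> y \<in> V j"
      "\<And>y. y \<in> topspace Y \<Longrightarrow> \<exists>j\<le>n. \<psi> j y = 0 \<and> 0 < \<psi> (Suc j) y"
    using metrizable_space_cover_chain[OF assms(4-6)] by blast
  define G where "G p = {z \<in> topspace (prod_topology X Y).
      max (\<phi> (fst p) (fst z)) (\<psi> (snd p) (snd z)) <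
      min (\<phi> (Suc (fst p)) (fst z)) (\<psi> (Suc (snd p)) (snd z))}" for p
  show ?thesis
  proof (rule that)
    fix i j assume ij: "i \<le> m" "j \<le> n"
    have c: "continuous_map (prod_topology X Y) euclideanreal (\<lambda>z. \<phi> k (fst z))" if "k \<le> Suc m" for k
      using continuous_map_compose[OF continuous_map_fst \<phi>(1)[OF that]] by (simp add: o_def)
    have c': "continuous_map (prod_topology X Y) euclideanreal (\<lambda>z. \<psi> k (snd z))" if "k \<le> Suc n" for k
      using continuous_map_compose[OF continuous_map_snd \<psi>(1)[OF that]] by (simp add: o_def)
    \<comment> \<open>Membership in \<open>G (i, j)\<close> is positivity of this continuous gap, an
      open condition.\<close>
    define \<delta> where "\<delta> z = min (\<phi> (Suc i) (fst z)) (\<psi> (Suc j) (snd z)) -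
        max (\<phi> i (fst z)) (\<psi> j (snd z))" for z
    have "continuous_map (prod_topology X Y) euclideanreal \<delta>"
      unfolding \<delta>_def using ij
      by (intro continuous_map_diff continuous_map_real_min continuous_map_real_max c c') auto
    then have "openin (prod_topology X Y) {z \<in> topspace (prod_topology X Y). \<delta> z \<in> {0<..}}"
      by (rule openin_continuous_map_preimage) simp
    moreover have "G (i, j) = {z \<in> topspace (prod_topology X Y). \<delta> z \<in> {0<..}}"
      by (simp add: G_def \<delta>_def)
    ultimately show "openin (prod_topology X Y) (G (i, j))" by simp
    show "G (i, j) \<subseteq> U i \<times> V j"
      using \<phi>(3)[OF ij(1)] \<psi>(3)[OF ij(2)] by (auto simp: G_def)
  next
    fix k
    \<comment> \<open>For \<open>i < i'\<close> and \<open>j' < j\<close> a common point would give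
      \<open>\<phi>\<^sub>i\<^sub>+\<^sub>1 \<le> \<phi>\<^sub>i\<^sub>' < \<psi>\<^sub>j\<^sub>'\<^sub>+\<^sub>1 \<le> \<psi>\<^sub>j < \<phi>\<^sub>i\<^sub>+\<^sub>1\<close>.\<close>
    have "G p \<inter> G q = {}" if "fst p < fst q" "fst p + snd p = k" "fst q + snd q = k" for p q
    proof -
      have "\<not> (z \<in> G p \<and> z \<in> G q)" for z
        using \<phi>(2)[of "Suc (fst p)" "fst q" "fst z"] \<psi>(2)[of "Suc (snd q)" "snd p" "snd z"] that
        by (auto simp: G_def)
      then show ?thesis by blast
    qed
    \<comment> \<open>Distinct pairs with equal sum differ in the first coordinate, so the ordered
      case suffices up to swapping \<open>p\<close> and \<open>q\<close>.\<close>
    moreover have "fst p < fst q \<or> fst q < fst p"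
      if "p \<noteq> q" "fst p + snd p = k" "fst q + snd q = k" for p q :: "nat \<times> nat"
      using that by (cases p, cases q) auto
    ultimately show "disjoint_family_on G {p. fst p + snd p = k}"
      unfolding disjoint_family_on_def by blast
  next
    have "(x, y) \<in> (\<Union>p\<in>{..m} \<times> {..n}. G p)" if xy: "x \<in> topspace X" "y \<in> topspace Y" for x y
    proof -
      \<comment> \<open>For these indices both intervals start at 0 and have positive length, so
        they overlap.\<close>
      obtain i j where "i \<le> m" "\<phi> i x = 0" "0 < \<phi> (Suc i) x" "j \<le> n" "\<psi> j y = 0" "0 < \<psi> (Suc j) y"
        using \<phi>(4)[OF xy(1)] \<psi>(4)[OF xy(2)] by blast
      then show ?thesis using xy by (intro UN_I[of "(i, j)"]) (auto simp: G_def)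
    qed
    then show "(\<Union>p\<in>{..m} \<times> {..n}. G p) = topspace X \<times> topspace Y"
      by (auto simp: G_def)
  qed
qed

section \<open>Subadditivity\<close>

lemma e_secat_le:
  assumes "\<And>i. i \<le> k \<Longrightarrow> e_sectional X Y f (U i)" "(\<Union>i\<le>k. U i) = topspace (topol Y)"
  shows "e_secat X Y f \<le> enat k"
  unfolding e_secat_def using assms by (intro Inf_lower) blast

text \<open>A finite value excludes the empty set, whose infimum is \<open>\<infinity>\<close>; the
  infimum of a nonempty set in \<open>enat\<close> is its least element, so the value is attained by
  a cover.\<close>

lemma e_secat_eq_enatE:
  assumes "e_secat X Y f = enat k"
  obtains U :: "nat \<Rightarrow> 'b set" where
    "\<And>i. i \<le> k \<Longrightarrow> e_sectional X Y f (U i)" "(\<Union>i\<le>k. U i) = topspace (topol Y)"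
proof -
  let ?S = "{enat k | k. \<exists>U :: nat \<Rightarrow> 'b set.
            (\<forall>i \<le> k. e_sectional X Y f (U i)) \<and> (\<Union>i \<le> k. U i) = topspace (topol Y)}"
  have eq: "Inf ?S = enat k" using assms by (simp add: e_secat_def)
  then have "?S \<noteq> {}" unfolding Inf_enat_def by (metis enat.distinct(1))
  then obtain x where "x \<in> ?S" by blast
  then have "(LEAST x. x \<in> ?S) \<in> ?S" by (rule LeastI[where P = "\<lambda>x. x \<in> ?S"])
  then have "Inf ?S \<in> ?S" using \<open>?S \<noteq> {}\<close> unfolding Inf_enat_def by (simp only: if_False)
  then show ?thesis using that unfolding eq by blast
qed

theorem proposition2p9:
  fixes E :: "'a ext_space" and B :: "'b ext_space"
    and E' :: "'c ext_space" and B' :: "'d ext_space"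
    and f :: "'a \<Rightarrow> 'b" and g :: "'c \<Rightarrow> 'd"
  assumes "exterior_space E" "exterior_space B" "exterior_space E'" "exterior_space B'"
    and "metrizable_space (topol E)" "metrizable_space (topol B)"
        "metrizable_space (topol E')" "metrizable_space (topol B')"
    and "exterior_map E B f" "exterior_map E' B' g"
  shows "e_secat (ext_prod E E') (ext_prod B B') (map_prod f g) \<le> e_secat E B f + e_secat E' B' g"
proof (cases "e_secat E B f + e_secat E' B' g")
  \<comment> \<open>An infinite sum bounds everything; a finite one forces both summands to be
    finite.\<close>
  case (enat l)
  then obtain m n where mn: "e_secat E B f = enat m" "e_secat E' B' g = enat n"
    by (metis enat.exhaust plus_enat_simps(2,3) enat.distinct(1))
  obtain U where U: "\<And>i. i \<le> m \<Longrightarrow> e_sectional E B f (U i)" "(\<Union>i\<le>m. U i) = topspace (topol B)"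
    using e_secat_eq_enatE[OF mn(1)] by blast
  obtain V where V: "\<And>j. j \<le> n \<Longrightarrow> e_sectional E' B' g (V j)" "(\<Union>j\<le>n. V j) = topspace (topol B')"
    using e_secat_eq_enatE[OF mn(2)] by blast
  have op: "\<And>i. i \<le> m \<Longrightarrow> openin (topol B) (U i)" "\<And>j. j \<le> n \<Longrightarrow> openin (topol B') (V j)"
    using U(1) V(1) by (auto simp: e_sectional_def)
  obtain G where G: "\<And>i j. \<lbrakk>i \<le> m; j \<le> n\<rbrakk> \<Longrightarrow> openin (prod_topology (topol B) (topol B')) (G (i, j))"
      "\<And>i j. \<lbrakk>i \<le> m; j \<le> n\<rbrakk> \<Longrightarrow> G (i, j) \<subseteq> U i \<times> V j"
      "\<And>k. disjoint_family_on G {p. fst p + snd p = k}"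
      "(\<Union>p\<in>{..m} \<times> {..n}. G p) = topspace (topol B) \<times> topspace (topol B')"
    using metrizable_space_product_cover[OF assms(6) op(1) U(2) assms(8) op(2) V(2)] by blast
  \<comment> \<open>Antidiagonals of the index grid: on each of them the sets \<open>G p\<close> are
    pairwise disjoint and can be merged into one e-sectional set.\<close>
  define J where "J k = {p \<in> {..m} \<times> {..n}. fst p + snd p = k}" for k
  have "e_secat (ext_prod E E') (ext_prod B B') (map_prod f g) \<le> enat (m + n)"
  proof (rule e_secat_le)
    fix k
    show "e_sectional (ext_prod E E') (ext_prod B B') (map_prod f g) (\<Union>p\<in>J k. G p)"
    proof (rule e_sectional_UN)
      show "exterior_space (ext_prod B B')" using assms(2,4) by (rule exterior_space_ext_prod)
      show "finite (J k)" by (simp add: J_def)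
      show "disjoint_family_on G (J k)"
        by (rule disjoint_family_on_mono[OF _ G(3)[of k]]) (auto simp: J_def)
      fix p assume "p \<in> J k"
      then obtain i j where p: "p = (i, j)" "i \<le> m" "j \<le> n" by (auto simp: J_def)
      show "e_sectional (ext_prod E E') (ext_prod B B') (map_prod f g) (G p)"
        unfolding p(1)
      proof (rule e_sectional_subset)
        show "exterior_space (ext_prod B B')" using assms(2,4) by (rule exterior_space_ext_prod)
        show "e_sectional (ext_prod E E') (ext_prod B B') (map_prod f g) (U i \<times> V j)"
          using assms(2,4) U(1)[OF p(2)] V(1)[OF p(3)] by (rule e_sectional_Times)
        show "openin (topol (ext_prod B B')) (G (i, j))"
          using G(1)[OF p(2,3)] by simp
        show "G (i, j) \<subseteq> U i \<times> V j"
          using G(2)[OF p(2,3)] .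
      qed
    qed
  next
    \<comment> \<open>Index sums run from 0 to \<open>m + n\<close>, so \<open>m + n + 1\<close>
      antidiagonals exhaust the grid, which is the count that the bound \<open>m + n\<close> stands
      for.\<close>
    have "(\<Union>k\<le>m + n. J k) = {..m} \<times> {..n}" by (auto simp: J_def)
    moreover have "(\<Union>k\<le>m + n. \<Union>p\<in>J k. G p) = (\<Union>p\<in>(\<Union>k\<le>m + n. J k). G p)" by blast
    ultimately show "(\<Union>k\<le>m + n. \<Union>p\<in>J k. G p) = topspace (topol (ext_prod B B'))"
      using G(4) by simp
  qed
  then show ?thesis using mn by simp
qed simp

end
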